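(* Every minimally inscribed triangle has a taxicab excircle at each of its three sides.
   Context: All triangles are non-degenerate and lie in $\mathbb{R}^2$ with the taxicab distance $d((x_1,y_1),(x_2,y_2))=|x_1-x_2|+|y_1-y_2|$. A taxicab circle of center $P$ and radius $r>0$ is $\{Q: d(P,Q)=r\}$ (a square with sides of slope $\pm1$); its closed disk is $\{Q:d(P,Q)\le r\}$. Inscribed angles: an angle (of a triangle) with vertex $V$ is positively inscribed if the line of slope $+1$ through $V$ does not meet the interior of the angle, and negatively inscribed if the line of slope $-1$ through $V$ does not meet the interior of the angle. It is completely inscribed if it is both positively and negatively inscribed, and inscribed if it is at least one of the two. A triangle is an inscribed triangle if all of its angles are inscribed. A triangle is minimally inscribed if it has only one (exactly one) completely inscribed angle. Excircles: an excircle of a triangle at a side is a taxicab circle outside the triangle that is tangent to that side and tangent to both rays forming the angle of the triangle opposite that side. Precisely, for the side $\overline{AB}$ of $\triangle ABC$: its closed disk lies in the closed angular region $\angle ACB$ and in the closed half-plane bounded by line $AB$ not containing $C$, and the circle has at least one point in common with the segment $\overline{AB}$, with the ray from $C$ through $A$, and with the ray from $C$ through $B$ (contact may be at a corner of the circle, along a segment, or at a vertex of the triangle). *)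

theory Defs
  imports "HOL-Analysis.Analysis"
begin

type_synonym point = "real \<times> real"

(* The library metric on real * real is the Euclidean one, so the taxicab distance, circle
   and disk are defined separately.  Topological notions such as interior do not depend on
   this choice. *)

definition taxi_dist :: "point \<Rightarrow> point \<Rightarrow> real" where
  "taxi_dist P Q = \<bar>fst P - fst Q\<bar> + \<bar>snd P - snd Q\<bar>"

definition taxi_circle :: "point \<Rightarrow> real \<Rightarrow> point set" where
  "taxi_circle P r = {Q. taxi_dist P Q = r}"

definition taxi_disk :: "point \<Rightarrow> real \<Rightarrow> point set" where
  "taxi_disk P r = {Q. taxi_dist P Q \<le> r}"

definition triangle :: "point \<Rightarrow> point \<Rightarrow> point \<Rightarrow> bool" where
  "triangle A B C \<longleftrightarrow> \<not> collinear {A, B, C}"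

definition ray :: "point \<Rightarrow> point \<Rightarrow> point set" where
  "ray V A = {V + t *\<^sub>R (A - V) | t. 0 \<le> t}"

(* In angle_region V A B and everything built on it, the vertex V of the angle comes first. *)

definition angle_region :: "point \<Rightarrow> point \<Rightarrow> point \<Rightarrow> point set" where
  "angle_region V A B = {V + s *\<^sub>R (A - V) + t *\<^sub>R (B - V) | s t. 0 \<le> s \<and> 0 \<le> t}"

definition line_of_slope :: "real \<Rightarrow> point \<Rightarrow> point set" where
  "line_of_slope m V = {Q. snd Q - snd V = m * (fst Q - fst V)}"

definition positively_inscribed :: "point \<Rightarrow> point \<Rightarrow> point \<Rightarrow> bool" where
  "positively_inscribed V A B \<longleftrightarrow> line_of_slope 1 V \<inter> interior (angle_region V A B) = {}"

definition negatively_inscribed :: "point \<Rightarrow> point \<Rightarrow> point \<Rightarrow> bool" where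
  "negatively_inscribed V A B \<longleftrightarrow> line_of_slope (-1) V \<inter> interior (angle_region V A B) = {}"

definition completely_inscribed :: "point \<Rightarrow> point \<Rightarrow> point \<Rightarrow> bool" where
  "completely_inscribed V A B \<longleftrightarrow> positively_inscribed V A B \<and> negatively_inscribed V A B"

definition minimally_inscribed :: "point \<Rightarrow> point \<Rightarrow> point \<Rightarrow> bool" where
  "minimally_inscribed A B C \<longleftrightarrow>
     triangle A B C \<and>
     ((completely_inscribed A B C \<and> \<not> completely_inscribed B C A \<and> \<not> completely_inscribed C A B) \<or>
      (\<not> completely_inscribed A B C \<and> completely_inscribed B C A \<and> \<not> completely_inscribed C A B) \<or>
      (\<not> completely_inscribed A B C \<and> \<not> completely_inscribed B C A \<and> completely_inscribed C A B))"

(* The closed half-plane bounded by the line AB that does not contain C (for A, B, C not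
   collinear): s moves along the line, t moves away from C. *)

definition opposite_halfplane :: "point \<Rightarrow> point \<Rightarrow> point \<Rightarrow> point set" where
  "opposite_halfplane A B C = {A + s *\<^sub>R (B - A) + t *\<^sub>R (A - C) | s t. 0 \<le> t}"

(* Excircle at the side AB of the triangle ABC; C is the opposite vertex. *)

definition taxi_excircle :: "point \<Rightarrow> real \<Rightarrow> point \<Rightarrow> point \<Rightarrow> point \<Rightarrow> bool" where
  "taxi_excircle P r A B C \<longleftrightarrow>
     0 < r \<and>
     taxi_disk P r \<subseteq> angle_region C A B \<and>
     taxi_disk P r \<subseteq> opposite_halfplane A B C \<and>
     taxi_circle P r \<inter> closed_segment A B \<noteq> {} \<and>
     taxi_circle P r \<inter> ray C A \<noteq> {} \<and>
     taxi_circle P r \<inter> ray C B \<noteq> {}"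

end

theory Submission
  imports Defs
begin

text \<open>
  In the coordinates \<open>u = x + y\<close>, \<open>v = y - x\<close> taxicab disks become axis-parallel squares, and an
  angle is completely inscribed iff it lies in a closed axis-parallel quadrant.  Put the only
  completely inscribed angle at \<open>C = (0, 0)\<close> in the first quadrant.  That the angles at
  \<open>A = (a1, a2)\<close> and \<open>B = (b1, b2)\<close> are not completely inscribed then means, up to swapping \<open>A\<close>
  and \<open>B\<close>, that \<open>0 < b1 < a1\<close> and \<open>0 < a2 < b2\<close>.  For the side \<open>AB\<close> the square has its lower
  left corner at \<open>(b1 A + a2 B) / (b1 + a2)\<close> and its two neighbouring corners on the rays \<open>CA\<close>
  and \<open>CB\<close>.  For each of the other two sides it has a corner at \<open>C\<close> and another one on the line
  \<open>AB\<close>.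
\<close>

section \<open>Cross products and membership in angles and half-planes\<close>

definition cross :: "point \<Rightarrow> point \<Rightarrow> real" where
  "cross P Q = fst P * snd Q - snd P * fst Q"

lemma cross_eq_0_imp_collinear:
  assumes "cross P Q = 0"
  shows "collinear {0, P, Q}"
proof (cases "P = 0")
  case False
  have "\<exists>c. Q = c *\<^sub>R P"
  proof (cases "fst P = 0")
    case True
    then have "snd P \<noteq> 0" using False by (simp add: prod_eq_iff)
    then show ?thesis using True assms
      by (intro exI[of _ "snd Q / snd P"]) (auto simp: cross_def prod_eq_iff)
  next
    case False
    then show ?thesis using assms
      by (intro exI[of _ "fst Q / fst P"]) (auto simp: cross_def prod_eq_iff field_simps)
  qed
  then show ?thesis by (simp add: collinear_lemma)
qed simp

lemma triangle_cross_nonzero: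
  assumes "triangle A B C"
  shows "cross (B - A) (C - A) \<noteq> 0"
proof
  assume "cross (B - A) (C - A) = 0"
  then have "collinear {B, A, C}"
    by (subst collinear_3) (auto intro: cross_eq_0_imp_collinear)
  with assms show False by (simp add: triangle_def insert_commute)
qed

text \<open>Cramer's rule in the plane, multiplied through by the determinant.\<close>

lemma cross_expand:
  "cross A B *\<^sub>R Q = cross Q B *\<^sub>R A + cross A Q *\<^sub>R B"
  by (simp add: cross_def prod_eq_iff algebra_simps)

text \<open>By Cramer's rule the coordinates of \<open>Q - V\<close> along the two arms are the two
  assumed nonnegative cross products divided by the positive one.\<close>

lemma angle_regionI:
  assumes "cross (A - V) (B - V) > 0" "cross (Q - V) (B - V) \<ge> 0" "cross (A - V) (Q - V) \<ge> 0"
  shows "Q \<in> angle_region V A B"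
proof -
  let ?d = "cross (A - V) (B - V)"
  have "Q - V = (1 / ?d) *\<^sub>R (?d *\<^sub>R (Q - V))"
    using assms(1) by simp
  also have "\<dots> = (cross (Q - V) (B - V) / ?d) *\<^sub>R (A - V) + (cross (A - V) (Q - V) / ?d) *\<^sub>R (B - V)"
    by (subst cross_expand) (simp add: scaleR_add_right)
  finally have "Q = V + (cross (Q - V) (B - V) / ?d) *\<^sub>R (A - V) + (cross (A - V) (Q - V) / ?d) *\<^sub>R (B - V)"
    by (simp add: algebra_simps)
  then show ?thesis
    using assms unfolding angle_region_def
    by (metis (mono_tags, lifting) divide_nonneg_pos mem_Collect_eq)
qed

text \<open>Cramer's rule in the basis \<open>B - A\<close>, \<open>A - C\<close>. The determinant
  of this basis is negative, so the coefficient of \<open>A - C\<close> is nonnegative when the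
  cross product with \<open>Q - A\<close> is nonpositive.\<close>

lemma opposite_halfplaneI:
  assumes "cross (A - C) (B - C) > 0" "cross (B - A) (Q - A) \<le> 0"
  shows "Q \<in> opposite_halfplane A B C"
proof -
  let ?d = "cross (B - A) (A - C)"
  have d: "?d < 0" using assms(1) by (simp add: cross_def algebra_simps)
  have "Q - A = (1 / ?d) *\<^sub>R (?d *\<^sub>R (Q - A))"
    using d by simp
  also have "\<dots> = (cross (Q - A) (A - C) / ?d) *\<^sub>R (B - A) + (cross (B - A) (Q - A) / ?d) *\<^sub>R (A - C)"
    by (subst cross_expand) (simp add: scaleR_add_right)
  finally have "Q = A + (cross (Q - A) (A - C) / ?d) *\<^sub>R (B - A) + (cross (B - A) (Q - A) / ?d) *\<^sub>R (A - C)"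
    by (simp add: algebra_simps)
  then show ?thesis
    using assms(2) d unfolding opposite_halfplane_def
    by (metis (mono_tags, lifting) divide_nonpos_neg mem_Collect_eq)
qed

lemma angle_region_commute: "angle_region V A B = angle_region V B A"
  by (force simp: angle_region_def add_ac)

text \<open>Substituting \<open>A - C = (A - B) + (B - C)\<close> changes only the coefficient along
  the line, not \<open>t\<close>.\<close>

lemma opposite_halfplane_subset_commute: "opposite_halfplane A B C \<subseteq> opposite_halfplane B A C"
proof
  fix Q assume "Q \<in> opposite_halfplane A B C"
  then obtain s t where "t \<ge> 0" "Q = A + s *\<^sub>R (B - A) + t *\<^sub>R (A - C)"
    by (auto simp: opposite_halfplane_def)
  then have "Q = B + (1 - s + t) *\<^sub>R (A - B) + t *\<^sub>R (B - C)"
    by (simp add: algebra_simps)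
  with \<open>t \<ge> 0\<close> show "Q \<in> opposite_halfplane B A C"
    unfolding opposite_halfplane_def by blast
qed

lemma taxi_excircle_commute: "taxi_excircle P r A B C \<longleftrightarrow> taxi_excircle P r B A C"
  using opposite_halfplane_subset_commute[of A B C] opposite_halfplane_subset_commute[of B A C]
  by (auto simp: taxi_excircle_def angle_region_commute[of C A B] closed_segment_commute[of A B])

section \<open>Inscribed angles as sign conditions\<close>

text \<open>For a counterclockwise pair of arms, strict positivity of both cross products cuts out
  an open subset of the angle that contains the point. A clockwise pair is swapped first.\<close>

lemma interior_angle_regionI:
  assumes "cross (A - V) (B - V) \<noteq> 0" "s > 0" "t > 0"
  shows "V + s *\<^sub>R (A - V) + t *\<^sub>R (B - V) \<in> interior (angle_region V A B)"
proof -
  have *: "V + s *\<^sub>R (A - V) + t *\<^sub>R (B - V) \<in> interior (angle_region V A B)"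
    if d: "cross (A - V) (B - V) > 0" and st: "s > 0" "t > 0" for A B s t
  proof (rule interiorI)
    let ?S = "{Q. 0 < cross (Q - V) (B - V)} \<inter> {Q. 0 < cross (A - V) (Q - V)}"
    show "open ?S"
      unfolding cross_def by (intro open_Int open_Collect_less continuous_intros)
    show "?S \<subseteq> angle_region V A B"
      using d by (auto intro: angle_regionI)
    have "cross (s *\<^sub>R (A - V) + t *\<^sub>R (B - V)) (B - V) = s * cross (A - V) (B - V)"
         "cross (A - V) (s *\<^sub>R (A - V) + t *\<^sub>R (B - V)) = t * cross (A - V) (B - V)"
      by (simp_all add: cross_def algebra_simps)
    then show "V + s *\<^sub>R (A - V) + t *\<^sub>R (B - V) \<in> ?S"
      using d st by (simp add: add.assoc)
  qed
  show ?thesis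
  proof (cases "cross (A - V) (B - V) > 0")
    case True
    then show ?thesis using * assms by blast
  next
    case False
    then have "cross (B - V) (A - V) > 0" using assms(1) by (simp add: cross_def algebra_simps)
    from *[OF this \<open>t > 0\<close> \<open>s > 0\<close>] show ?thesis
      by (simp add: angle_region_commute[of V A B] add_ac)
  qed
qed

text \<open>The line through \<open>V\<close> with normal \<open>n\<close> misses the interior
  exactly when the arms do not point strictly to opposite sides of it. If they do not, the angle
  lies in a closed half-plane, and its interior in the open one.\<close>

lemma line_Int_interior_angle_region:
  fixes n :: point
  assumes d: "cross (A - V) (B - V) \<noteq> 0" and n: "n \<noteq> 0"
  shows "{Q. n \<bullet> (Q - V) = 0} \<inter> interior (angle_region V A B) = {} \<longleftrightarrow>
         (n \<bullet> (A - V)) * (n \<bullet> (B - V)) \<ge> 0"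
proof
  assume e: "{Q. n \<bullet> (Q - V) = 0} \<inter> interior (angle_region V A B) = {}"
  show "(n \<bullet> (A - V)) * (n \<bullet> (B - V)) \<ge> 0"
  proof (rule ccontr)
    assume neg: "\<not> (n \<bullet> (A - V)) * (n \<bullet> (B - V)) \<ge> 0"
    then have p: "\<bar>n \<bullet> (B - V)\<bar> > 0" "\<bar>n \<bullet> (A - V)\<bar> > 0" by auto
    \<comment> \<open>Each arm is weighted by the other arm's distance from the line (up to the
      length of \<open>n\<close>), so that the two opposite normal components cancel.\<close>
    let ?Q = "V + \<bar>n \<bullet> (B - V)\<bar> *\<^sub>R (A - V) + \<bar>n \<bullet> (A - V)\<bar> *\<^sub>R (B - V)"
    have "n \<bullet> (?Q - V) = \<bar>n \<bullet> (B - V)\<bar> * (n \<bullet> (A - V)) + \<bar>n \<bullet> (A - V)\<bar> * (n \<bullet> (B - V))"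
      by (simp add: inner_add_right inner_diff_right)
    also have "\<dots> = 0"
      using neg by (auto simp: not_le mult_less_0_iff)
    finally show False using interior_angle_regionI[OF d p] e by blast
  qed
next
  have *: "{Q. m \<bullet> (Q - V) = 0} \<inter> interior (angle_region V A B) = {}"
    if m: "m \<noteq> 0" "m \<bullet> (A - V) \<ge> 0" "m \<bullet> (B - V) \<ge> 0" for m
  proof -
    have "angle_region V A B \<subseteq> {Q. m \<bullet> Q \<ge> m \<bullet> V}"
    proof
      fix Q assume "Q \<in> angle_region V A B"
      then obtain s t where "s \<ge> 0" "t \<ge> 0" "Q = V + s *\<^sub>R (A - V) + t *\<^sub>R (B - V)"
        by (auto simp: angle_region_def)
      then have "m \<bullet> Q = m \<bullet> V + (s * (m \<bullet> (A - V)) + t * (m \<bullet> (B - V)))"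
        by (simp add: inner_add_right)
      then show "Q \<in> {Q. m \<bullet> Q \<ge> m \<bullet> V}"
        using m \<open>s \<ge> 0\<close> \<open>t \<ge> 0\<close> by simp
    qed
    then have "interior (angle_region V A B) \<subseteq> {Q. m \<bullet> Q > m \<bullet> V}"
      using interior_mono interior_halfspace_ge[OF m(1)] by metis
    then show ?thesis by (auto simp: inner_diff_right)
  qed
  assume "(n \<bullet> (A - V)) * (n \<bullet> (B - V)) \<ge> 0"
  then have "n \<bullet> (A - V) \<ge> 0 \<and> n \<bullet> (B - V) \<ge> 0 \<or> -n \<bullet> (A - V) \<ge> 0 \<and> -n \<bullet> (B - V) \<ge> 0"
    by (auto simp: zero_le_mult_iff)
  then show "{Q. n \<bullet> (Q - V) = 0} \<inter> interior (angle_region V A B) = {}"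
    using *[of n] *[of "-n"] n by auto
qed

definition diag_sum :: "point \<Rightarrow> real" where "diag_sum P = fst P + snd P"

definition diag_diff :: "point \<Rightarrow> real" where "diag_diff P = snd P - fst P"

text \<open>The lines of slope 1 and -1 have normals \<open>(-1, 1)\<close> and
  \<open>(1, 1)\<close>; pairing with these gives \<open>diag_diff\<close> and
  \<open>diag_sum\<close>.\<close>

lemma completely_inscribed_iff:
  assumes "triangle V A B"
  shows "completely_inscribed V A B \<longleftrightarrow>
         (diag_diff A - diag_diff V) * (diag_diff B - diag_diff V) \<ge> 0 \<and>
         (diag_sum A - diag_sum V) * (diag_sum B - diag_sum V) \<ge> 0"
proof -
  note d = triangle_cross_nonzero[OF assms]
  have "line_of_slope 1 V = {Q. (-1, 1) \<bullet> (Q - V) = 0}"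
       "line_of_slope (-1) V = {Q. (1, 1) \<bullet> (Q - V) = 0}"
    by (auto simp: line_of_slope_def inner_prod_def)
  then show ?thesis
    using line_Int_interior_angle_region[OF d, of "(-1, 1)"]
      line_Int_interior_angle_region[OF d, of "(1, 1)"]
    by (simp add: completely_inscribed_def positively_inscribed_def negatively_inscribed_def
        inner_prod_def diag_sum_def diag_diff_def algebra_simps zero_prod_def)
qed

section \<open>Diagonal coordinate frames\<close>

text \<open>
  The point with \<open>u\<close>, \<open>v\<close> coordinates \<open>\<sigma> * fst q\<close>, \<open>\<tau> * snd q\<close> relative to the origin \<open>W\<close>; the
  signs \<open>\<sigma>\<close>, \<open>\<tau>\<close> select the quadrant.
\<close>
definition frame :: "real \<Rightarrow> real \<Rightarrow> point \<Rightarrow> point \<Rightarrow> point" where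
  "frame \<sigma> \<tau> W q = (fst W + (\<sigma> * fst q - \<tau> * snd q) / 2, snd W + (\<sigma> * fst q + \<tau> * snd q) / 2)"

lemma frame_surj:
  assumes "\<bar>\<sigma>\<bar> = 1" "\<bar>\<tau>\<bar> = 1"
  shows "frame \<sigma> \<tau> W (\<sigma> * (diag_sum P - diag_sum W), \<tau> * (diag_diff P - diag_diff W)) = P"
proof -
  have "\<sigma> = 1 \<or> \<sigma> = - 1" "\<tau> = 1 \<or> \<tau> = - 1" using assms by linarith+
  then show ?thesis
    by (auto simp: frame_def diag_sum_def diag_diff_def prod_eq_iff field_simps)
qed

lemma frame_affine:
  "frame \<sigma> \<tau> W (v + s *\<^sub>R (a - b) + t *\<^sub>R (c - d)) =
   frame \<sigma> \<tau> W v + s *\<^sub>R (frame \<sigma> \<tau> W a - frame \<sigma> \<tau> W b) + t *\<^sub>R (frame \<sigma> \<tau> W c - frame \<sigma> \<tau> W d)"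
  by (simp add: frame_def prod_eq_iff field_simps)

text \<open>This identity turns the taxicab norm into the maximum norm in diagonal
  coordinates.\<close>

lemma abs_add_abs_eq_max:
  fixes x y :: real
  shows "\<bar>(x - y) / 2\<bar> + \<bar>(x + y) / 2\<bar> = max \<bar>x\<bar> \<bar>y\<bar>"
  by (simp add: abs_if max_def field_simps)

lemma taxi_dist_frame:
  assumes "\<bar>\<sigma>\<bar> = 1" "\<bar>\<tau>\<bar> = 1"
  shows "taxi_dist (frame \<sigma> \<tau> W p) (frame \<sigma> \<tau> W q) = max \<bar>fst p - fst q\<bar> \<bar>snd p - snd q\<bar>"
proof -
  have "taxi_dist (frame \<sigma> \<tau> W p) (frame \<sigma> \<tau> W q) =
    \<bar>(\<sigma> * (fst p - fst q) - \<tau> * (snd p - snd q)) / 2\<bar> + \<bar>(\<sigma> * (fst p - fst q) + \<tau> * (snd p - snd q)) / 2\<bar>"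
    unfolding taxi_dist_def frame_def
    by (rule arg_cong2[of _ _ _ _ "\<lambda>x y. \<bar>x\<bar> + \<bar>y\<bar>"]) (simp_all add: field_simps)
  also have "\<dots> = max \<bar>fst p - fst q\<bar> \<bar>snd p - snd q\<bar>"
    using assms by (simp only: abs_add_abs_eq_max abs_mult mult_1)
  finally show ?thesis .
qed

lemma frame_angle_region:
  "q \<in> angle_region v a b \<Longrightarrow>
   frame \<sigma> \<tau> W q \<in> angle_region (frame \<sigma> \<tau> W v) (frame \<sigma> \<tau> W a) (frame \<sigma> \<tau> W b)"
  unfolding angle_region_def using frame_affine by blast

lemma frame_opposite_halfplane:
  "q \<in> opposite_halfplane a b c \<Longrightarrow>
   frame \<sigma> \<tau> W q \<in> opposite_halfplane (frame \<sigma> \<tau> W a) (frame \<sigma> \<tau> W b) (frame \<sigma> \<tau> W c)"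
  unfolding opposite_halfplane_def using frame_affine by blast

lemma frame_affine1:
  "frame \<sigma> \<tau> W (v + s *\<^sub>R (a - v)) = frame \<sigma> \<tau> W v + s *\<^sub>R (frame \<sigma> \<tau> W a - frame \<sigma> \<tau> W v)"
  using frame_affine[of \<sigma> \<tau> W v s a v 0 v v] by simp

lemma frame_ray: "q \<in> ray v a \<Longrightarrow> frame \<sigma> \<tau> W q \<in> ray (frame \<sigma> \<tau> W v) (frame \<sigma> \<tau> W a)"
  by (auto simp: ray_def frame_affine1)

lemma closed_segment_eq_affine:
  fixes a b :: "'a::real_vector"
  shows "closed_segment a b = {a + t *\<^sub>R (b - a) | t. 0 \<le> t \<and> t \<le> 1}"
  by (auto simp: closed_segment_def algebra_simps)

lemma frame_closed_segment:
  "q \<in> closed_segment a b \<Longrightarrow> frame \<sigma> \<tau> W q \<in> closed_segment (frame \<sigma> \<tau> W a) (frame \<sigma> \<tau> W b)"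
  by (auto simp: closed_segment_eq_affine frame_affine1)

text \<open>Reduces an excircle to linear inequalities on a square and three contact points:
  \<open>e\<close> on the side, \<open>f\<close> and \<open>g\<close> on the rays. Orientation
  matters only before \<open>frame\<close> is applied: the inclusions are then carried over by
  affinity, so a choice of signs that reverses orientation does no harm.\<close>

lemma taxi_excircle_frameI:
  fixes a b c p e f g :: point
  assumes signs: "\<bar>\<sigma>\<bar> = 1" "\<bar>\<tau>\<bar> = 1"
    and r: "r > 0"
    and ccw: "cross (a - c) (b - c) > 0"
    and square: "\<And>x y. \<lbrakk>\<bar>x - fst p\<bar> \<le> r; \<bar>y - snd p\<bar> \<le> r\<rbrakk> \<Longrightarrow>
       cross ((x, y) - c) (b - c) \<ge> 0 \<and> cross (a - c) ((x, y) - c) \<ge> 0 \<and> cross (b - a) ((x, y) - a) \<le> 0"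
    and e: "e \<in> closed_segment a b" "max \<bar>fst p - fst e\<bar> \<bar>snd p - snd e\<bar> = r"
    and f: "f \<in> ray c a" "max \<bar>fst p - fst f\<bar> \<bar>snd p - snd f\<bar> = r"
    and g: "g \<in> ray c b" "max \<bar>fst p - fst g\<bar> \<bar>snd p - snd g\<bar> = r"
  shows "taxi_excircle (frame \<sigma> \<tau> W p) r (frame \<sigma> \<tau> W a) (frame \<sigma> \<tau> W b) (frame \<sigma> \<tau> W c)"
proof -
  let ?F = "frame \<sigma> \<tau> W"
  have disk: "Q \<in> angle_region (?F c) (?F a) (?F b) \<inter> opposite_halfplane (?F a) (?F b) (?F c)"
    if "Q \<in> taxi_disk (?F p) r" for Q
  proof -
    obtain x y where Q: "Q = ?F (x, y)" using frame_surj[OF signs, of W Q] by metis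
    with that have "\<bar>x - fst p\<bar> \<le> r" "\<bar>y - snd p\<bar> \<le> r"
      by (auto simp: taxi_disk_def taxi_dist_frame[OF signs] abs_minus_commute)
    from square[OF this] show ?thesis
      unfolding Q using ccw
      by (auto intro!: frame_angle_region frame_opposite_halfplane angle_regionI opposite_halfplaneI)
  qed
  have "?F e \<in> taxi_circle (?F p) r" "?F f \<in> taxi_circle (?F p) r" "?F g \<in> taxi_circle (?F p) r"
    using e(2) f(2) g(2) by (simp_all add: taxi_circle_def taxi_dist_frame[OF signs])
  then show ?thesis
    using r disk frame_closed_segment[OF e(1), of \<sigma> \<tau> W] frame_ray[OF f(1), of \<sigma> \<tau> W]
      frame_ray[OF g(1), of \<sigma> \<tau> W]
    unfolding taxi_excircle_def by blast
qed

section \<open>The three squares in normal position\<close>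

lemma taxi_excircles_of_quadrant:
  fixes W :: point
  assumes signs: "\<bar>\<sigma>\<bar> = 1" "\<bar>\<tau>\<bar> = 1"
    and u: "0 < b1" "b1 < a1" and v: "0 < a2" "a2 < b2"
  defines "A \<equiv> frame \<sigma> \<tau> W (a1, a2)" and "B \<equiv> frame \<sigma> \<tau> W (b1, b2)" and "C \<equiv> frame \<sigma> \<tau> W (0, 0)"
  shows "(\<exists>P r. taxi_excircle P r A B C) \<and> (\<exists>P r. taxi_excircle P r B C A) \<and>
         (\<exists>P r. taxi_excircle P r C A B)"
proof (intro conjI)
  \<comment> \<open>Twice the area of the triangle in frame coordinates; \<open>d > 0\<close> says
    that \<open>C\<close>, \<open>A\<close>, \<open>B\<close> run counterclockwise there.\<close>
  define d where "d = a1 * b2 - a2 * b1"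
  have "a2 * b1 < b2 * a1" using u v by (intro mult_strict_mono) auto
  then have d: "d > 0" by (simp add: d_def mult.commute)
  show "\<exists>P r. taxi_excircle P r A B C"
  proof -
    \<comment> \<open>From the point \<open>A + t (B - A)\<close> the ray \<open>CA\<close> is at
      horizontal distance \<open>t * d / a2\<close> and the ray \<open>CB\<close> at vertical
      distance \<open>(1 - t) * d / b1\<close>. The two agree for \<open>t = k * a2\<close>, and
      their common value \<open>k * d\<close> is the side of the square.\<close>
    define k where "k = 1 / (b1 + a2)"
    define r where "r = k * d / 2"
    define x0 where "x0 = k * (b1 * (a1 + a2))"
    define y0 where "y0 = k * (a2 * (b1 + b2))"
    have k: "k > 0" "k * (b1 + a2) = 1" using u v by (simp_all add: k_def)
    have r: "r > 0" using k d by (simp add: r_def)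
    have r2: "r * 2 = k * d" by (simp add: r_def)
    have right: "x0 + 2 * r = k * (b1 + b2) * a1" "y0 = k * (b1 + b2) * a2"
      and left: "y0 + 2 * r = k * (a1 + a2) * b2" "x0 = k * (a1 + a2) * b1"
      by (simp_all add: r2 x0_def y0_def d_def algebra_simps)
    have x0: "x0 = a1 + (k * a2) * (b1 - a1)" and y0: "y0 = a2 + (k * a2) * (b2 - a2)"
    proof -
      have "a1 = k * (b1 + a2) * a1" "a2 = k * (b1 + a2) * a2" using k(2) by simp_all
      moreover have "x0 = k * (b1 + a2) * a1 + (k * a2) * (b1 - a1)"
        "y0 = k * (b1 + a2) * a2 + (k * a2) * (b2 - a2)"
        by (simp_all add: x0_def y0_def algebra_simps)
      ultimately show "x0 = a1 + (k * a2) * (b1 - a1)" "y0 = a2 + (k * a2) * (b2 - a2)" by simp_all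
    qed
    have ka2: "0 \<le> k * a2" "k * a2 \<le> 1"
      using k u v by (simp_all add: k_def field_simps)
    have "taxi_excircle (frame \<sigma> \<tau> W (x0 + r, y0 + r)) r A B C"
      unfolding A_def B_def C_def
    proof (rule taxi_excircle_frameI[OF signs r, where e = "(x0, y0)"
          and f = "(x0 + 2 * r, y0)" and g = "(x0, y0 + 2 * r)"])
      show "cross ((a1, a2) - (0, 0)) ((b1, b2) - (0, 0)) > 0"
        using d by (simp add: cross_def d_def)
      show "(x0, y0) \<in> closed_segment (a1, a2) (b1, b2)"
        using ka2 by (auto simp: closed_segment_eq_affine x0 y0)
      show "(x0 + 2 * r, y0) \<in> ray (0, 0) (a1, a2)"
        unfolding right ray_def using k u v
        by (auto intro!: exI[of _ "k * (b1 + b2)"])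
      show "(x0, y0 + 2 * r) \<in> ray (0, 0) (b1, b2)"
        unfolding left ray_def using k u v
        by (auto intro!: exI[of _ "k * (a1 + a2)"])
    next
      fix x y assume "\<bar>x - fst (x0 + r, y0 + r)\<bar> \<le> r" "\<bar>y - snd (x0 + r, y0 + r)\<bar> \<le> r"
      then have xy: "x0 \<le> x" "x \<le> x0 + 2 * r" "y0 \<le> y" "y \<le> y0 + 2 * r" by auto
      \<comment> \<open>Each linear inequality is tightest at one corner: upper left for
        \<open>CB\<close>, lower right for \<open>CA\<close>, lower left for \<open>AB\<close>. At
        these corners equality holds.\<close>
      have "(y0 + 2 * r) * b1 = x0 * b2" unfolding left by simp
      moreover have "(x0 + 2 * r) * a2 = y0 * a1" unfolding right by simp
      moreover have "y * b1 \<le> (y0 + 2 * r) * b1" "x0 * b2 \<le> x * b2"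
        "x * a2 \<le> (x0 + 2 * r) * a2" "y0 * a1 \<le> y * a1"
        using xy u v by (auto intro!: mult_right_mono)
      moreover have "(b1 - a1) * (y - a2) \<le> (b1 - a1) * (y0 - a2)"
        "(b2 - a2) * (x0 - a1) \<le> (b2 - a2) * (x - a1)"
        using xy u v by (auto intro!: mult_left_mono mult_left_mono_neg)
      moreover have "(b1 - a1) * (y0 - a2) = (b2 - a2) * (x0 - a1)"
        by (simp add: x0 y0)
      ultimately show "cross ((x, y) - (0, 0)) ((b1, b2) - (0, 0)) \<ge> 0 \<and>
          cross ((a1, a2) - (0, 0)) ((x, y) - (0, 0)) \<ge> 0 \<and>
          cross ((b1, b2) - (a1, a2)) ((x, y) - (a1, a2)) \<le> 0"
        by (simp add: cross_def mult.commute)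
    qed (use r in auto)
    then show ?thesis by blast
  qed
  show "\<exists>P r. taxi_excircle P r B C A"
  proof -
    \<comment> \<open>The line \<open>AB\<close> meets the vertical axis at \<open>(0, h)\<close>,
      beyond \<open>B\<close> as seen from \<open>A\<close>. The square of side \<open>h\<close> to
      the left of that axis has its lower right corner at \<open>C\<close> and its upper right
      corner at this point.\<close>
    define h where "h = d / (a1 - b1)"
    define r where "r = h / 2"
    have h: "2 * r = h" by (simp add: r_def)
    have r: "r > 0" using d u by (simp add: r_def h_def)
    have r2: "(a1 - b1) * (2 * r) = d" unfolding h using u by (simp add: h_def)
    have "a2 + a1 / z * (b2 - a2) = (a1 * b2 - a2 * (a1 - z)) / z" if "z \<noteq> 0" for z
      using that by (simp add: field_simps)
    from this[of "a1 - b1"] have "2 * r = a2 + a1 / (a1 - b1) * (b2 - a2)"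
      unfolding h using u by (simp add: h_def d_def)
    moreover have "a1 + a1 / (a1 - b1) * (b1 - a1) = 0"
      using u by (simp add: field_simps)
    ultimately have corner: "(0, 2 * r) = (a1, a2) + (a1 / (a1 - b1)) *\<^sub>R ((b1, b2) - (a1, a2))"
      by simp
    have "taxi_excircle (frame \<sigma> \<tau> W (- r, r)) r B C A"
      unfolding A_def B_def C_def
    proof (rule taxi_excircle_frameI[OF signs r, where e = "(0, 0)"
          and f = "(0, 2 * r)" and g = "(0, 0)"])
      show "cross ((b1, b2) - (a1, a2)) ((0, 0) - (a1, a2)) > 0"
        using d by (simp add: cross_def d_def algebra_simps)
      show "(0, 2 * r) \<in> ray (a1, a2) (b1, b2)"
        unfolding ray_def corner by (intro CollectI exI conjI, rule refl) (use u in auto)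
      show "(0, 0) \<in> ray (a1, a2) (0, 0)"
        unfolding ray_def by (auto intro!: exI[of _ 1])
    next
      fix x y assume "\<bar>x - fst (- r, r)\<bar> \<le> r" "\<bar>y - snd (- r, r)\<bar> \<le> r"
      then have xy: "x \<le> 0" "0 \<le> y" "y \<le> 2 * r" by auto
      have "a2 * x \<le> 0" "0 \<le> a1 * y" "b2 * x \<le> 0" "0 \<le> b1 * y"
        using xy u v by (auto simp: mult_nonneg_nonpos)
      \<comment> \<open>The condition at the line \<open>AB\<close> reads
        \<open>(a1 - b1) * y + (b2 - a2) * x \<le> d\<close>, with equality at the upper right
        corner.\<close>
      moreover have "(a1 - b1) * y \<le> d"
        unfolding r2[symmetric] using xy u by (auto intro!: mult_left_mono)
      moreover have "(b2 - a2) * x \<le> 0"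
        using xy v by (auto simp: mult_nonneg_nonpos)
      ultimately show "cross ((x, y) - (a1, a2)) ((0, 0) - (a1, a2)) \<ge> 0 \<and>
          cross ((b1, b2) - (a1, a2)) ((x, y) - (a1, a2)) \<ge> 0 \<and>
          cross ((0, 0) - (b1, b2)) ((x, y) - (b1, b2)) \<le> 0"
        by (simp add: cross_def d_def algebra_simps)
    qed (use r in auto)
    then show ?thesis by blast
  qed
  show "\<exists>P r. taxi_excircle P r C A B"
  proof -
    \<comment> \<open>Mirror image of the previous case: \<open>AB\<close> meets the horizontal axis
      at \<open>(h, 0)\<close>, beyond \<open>A\<close> as seen from \<open>B\<close>, and the
      square hangs below that axis with its upper left corner at \<open>C\<close>.\<close>
    define h where "h = d / (b2 - a2)"
    define r where "r = h / 2"
    have h: "2 * r = h" by (simp add: r_def)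
    have r: "r > 0" using d v by (simp add: r_def h_def)
    have r2: "(b2 - a2) * (2 * r) = d" unfolding h using v by (simp add: h_def)
    have "b1 + b2 / z * (a1 - b1) = (a1 * b2 - (b2 - z) * b1) / z" if "z \<noteq> 0" for z
      using that by (simp add: field_simps)
    from this[of "b2 - a2"] have "2 * r = b1 + b2 / (b2 - a2) * (a1 - b1)"
      unfolding h using v by (simp add: h_def d_def)
    moreover have "b2 + b2 / (b2 - a2) * (a2 - b2) = 0"
      using v by (simp add: field_simps)
    ultimately have corner: "(2 * r, 0) = (b1, b2) + (b2 / (b2 - a2)) *\<^sub>R ((a1, a2) - (b1, b2))"
      by simp
    have "taxi_excircle (frame \<sigma> \<tau> W (r, - r)) r C A B"
      unfolding A_def B_def C_def
    proof (rule taxi_excircle_frameI[OF signs r, where e = "(0, 0)"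
          and f = "(0, 0)" and g = "(2 * r, 0)"])
      show "cross ((0, 0) - (b1, b2)) ((a1, a2) - (b1, b2)) > 0"
        using d by (simp add: cross_def d_def algebra_simps)
      show "(2 * r, 0) \<in> ray (b1, b2) (a1, a2)"
        unfolding ray_def corner by (intro CollectI exI conjI, rule refl) (use v in auto)
      show "(0, 0) \<in> ray (b1, b2) (0, 0)"
        unfolding ray_def by (auto intro!: exI[of _ 1])
    next
      fix x y assume "\<bar>x - fst (r, - r)\<bar> \<le> r" "\<bar>y - snd (r, - r)\<bar> \<le> r"
      then have xy: "y \<le> 0" "0 \<le> x" "x \<le> 2 * r" by auto
      have "b1 * y \<le> 0" "0 \<le> b2 * x" "a1 * y \<le> 0" "0 \<le> a2 * x"
        using xy u v by (auto simp: mult_nonneg_nonpos)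
      moreover have "(b2 - a2) * x \<le> d"
        unfolding r2[symmetric] using xy v by (auto intro!: mult_left_mono)
      moreover have "(a1 - b1) * y \<le> 0"
        using xy u by (auto simp: mult_nonneg_nonpos)
      ultimately show "cross ((x, y) - (b1, b2)) ((a1, a2) - (b1, b2)) \<ge> 0 \<and>
          cross ((0, 0) - (b1, b2)) ((x, y) - (b1, b2)) \<ge> 0 \<and>
          cross ((a1, a2) - (0, 0)) ((x, y) - (0, 0)) \<le> 0"
        by (simp add: cross_def d_def algebra_simps)
    qed (use r in auto)
    then show ?thesis by blast
  qed
qed

section \<open>Reduction to normal position\<close>

lemma mult_nonneg_obtain_sign:
  fixes x y :: real
  assumes "x * y \<ge> 0"
  obtains \<sigma> :: real where "\<bar>\<sigma>\<bar> = 1" "\<sigma> * x \<ge> 0" "\<sigma> * y \<ge> 0"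
  using assms that[of 1] that[of "-1"] by (auto simp: zero_le_mult_iff)

text \<open>With \<open>C\<close> at coordinate 0, failure of a sign condition at a vertex puts its
  coordinate \<open>x\<close> strictly between those of the other two vertices.\<close>

lemma mult_neg_interlaced:
  fixes x y :: real
  assumes "x \<ge> 0" "y \<ge> 0" "(y - x) * (0 - x) < 0"
  shows "0 < x \<and> x < y"
  using assms by (auto simp: mult_less_0_iff simp del: diff_0)

text \<open>One coordinate of \<open>A\<close> lies strictly between those of \<open>C\<close> and
  \<open>B\<close>, and one of \<open>B\<close> between those of \<open>C\<close> and
  \<open>A\<close>. These cannot be the same coordinate, which leaves two cases that differ by
  swapping \<open>A\<close> and \<open>B\<close>.\<close>

lemma taxi_excircles_of_completely_inscribed:
  assumes tri: "triangle C A B" "triangle A B C" "triangle B C A"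
    and C: "completely_inscribed C A B"
    and AB: "\<not> completely_inscribed A B C" "\<not> completely_inscribed B C A"
  shows "(\<exists>P r. taxi_excircle P r A B C) \<and> (\<exists>P r. taxi_excircle P r B C A) \<and>
         (\<exists>P r. taxi_excircle P r C A B)"
proof -
  note iff = tri[THEN completely_inscribed_iff]
  obtain \<sigma> where \<sigma>: "\<bar>\<sigma>\<bar> = 1" "\<sigma> * (diag_sum A - diag_sum C) \<ge> 0" "\<sigma> * (diag_sum B - diag_sum C) \<ge> 0"
    using C iff(1) mult_nonneg_obtain_sign by metis
  obtain \<tau> where \<tau>: "\<bar>\<tau>\<bar> = 1" "\<tau> * (diag_diff A - diag_diff C) \<ge> 0" "\<tau> * (diag_diff B - diag_diff C) \<ge> 0"
    using C iff(1) mult_nonneg_obtain_sign by metis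
  define a1 b1 a2 b2 where "a1 = \<sigma> * (diag_sum A - diag_sum C)" "b1 = \<sigma> * (diag_sum B - diag_sum C)"
    and "a2 = \<tau> * (diag_diff A - diag_diff C)" "b2 = \<tau> * (diag_diff B - diag_diff C)"
  note coords = this
  have nonneg: "a1 \<ge> 0" "b1 \<ge> 0" "a2 \<ge> 0" "b2 \<ge> 0"
    using \<sigma> \<tau> by (simp_all add: coords)
  have sq: "\<sigma> * \<sigma> = 1" "\<tau> * \<tau> = 1" using \<sigma>(1) \<tau>(1) by (metis abs_mult_self_eq mult_1)+
  \<comment> \<open>The origin \<open>C\<close> cancels in the differences, and each sign enters
    squared.\<close>
  have scale: "(diag_sum P - diag_sum Q) * (diag_sum R - diag_sum Q) =
      (\<sigma> * (diag_sum P - diag_sum C) - \<sigma> * (diag_sum Q - diag_sum C)) *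
      (\<sigma> * (diag_sum R - diag_sum C) - \<sigma> * (diag_sum Q - diag_sum C))"
    "(diag_diff P - diag_diff Q) * (diag_diff R - diag_diff Q) =
      (\<tau> * (diag_diff P - diag_diff C) - \<tau> * (diag_diff Q - diag_diff C)) *
      (\<tau> * (diag_diff R - diag_diff C) - \<tau> * (diag_diff Q - diag_diff C))" for P Q R
  proof -
    have "(z * p - z * q) * (z * r - z * q) = z * z * ((p - q) * (r - q))" for z p q r :: real
      by (simp add: algebra_simps)
    then show "(diag_sum P - diag_sum Q) * (diag_sum R - diag_sum Q) =
      (\<sigma> * (diag_sum P - diag_sum C) - \<sigma> * (diag_sum Q - diag_sum C)) *
      (\<sigma> * (diag_sum R - diag_sum C) - \<sigma> * (diag_sum Q - diag_sum C))"
    "(diag_diff P - diag_diff Q) * (diag_diff R - diag_diff Q) =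
      (\<tau> * (diag_diff P - diag_diff C) - \<tau> * (diag_diff Q - diag_diff C)) *
      (\<tau> * (diag_diff R - diag_diff C) - \<tau> * (diag_diff Q - diag_diff C))"
      by (simp_all add: sq)
  qed
  have "(b2 - a2) * (0 - a2) < 0 \<or> (b1 - a1) * (0 - a1) < 0"
    using AB(1) unfolding iff(2) scale coords by (simp add: not_le)
  then have A: "0 < a2 \<and> a2 < b2 \<or> 0 < a1 \<and> a1 < b1"
    using mult_neg_interlaced nonneg by blast
  have "(a2 - b2) * (0 - b2) < 0 \<or> (a1 - b1) * (0 - b1) < 0"
    using AB(2) unfolding iff(3) scale coords by (simp add: not_le mult.commute)
  then have B: "0 < b2 \<and> b2 < a2 \<or> 0 < b1 \<and> b1 < a1"
    using mult_neg_interlaced nonneg by blast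
  have frames: "frame \<sigma> \<tau> C (a1, a2) = A" "frame \<sigma> \<tau> C (b1, b2) = B" "frame \<sigma> \<tau> C (0, 0) = C"
    using frame_surj[OF \<sigma>(1) \<tau>(1), of C] by (simp_all add: coords frame_def)
  from A B consider "0 < b1" "b1 < a1" "0 < a2" "a2 < b2" | "0 < a1" "a1 < b1" "0 < b2" "b2 < a2"
    by force
  then show ?thesis
  proof cases
    case 1
    then show ?thesis
      using taxi_excircles_of_quadrant[OF \<sigma>(1) \<tau>(1), of b1 a1 a2 b2 C] by (simp add: frames)
  next
    \<comment> \<open>The roles of \<open>A\<close> and \<open>B\<close> are exchanged; an excircle
      does not depend on the order of the endpoints of its side.\<close>
    case 2
    then show ?thesis
      using taxi_excircles_of_quadrant[OF \<sigma>(1) \<tau>(1), of a1 b1 b2 a2 C]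
      by (simp add: frames taxi_excircle_commute[of _ _ B A] taxi_excircle_commute[of _ _ A C]
          taxi_excircle_commute[of _ _ C B])
  qed
qed

theorem lemma2:
  fixes A B C :: point
  assumes "minimally_inscribed A B C"
  shows "(\<exists>P r. taxi_excircle P r A B C) \<and>
         (\<exists>P r. taxi_excircle P r B C A) \<and>
         (\<exists>P r. taxi_excircle P r C A B)"
proof -
  have tri: "triangle A B C" "triangle B C A" "triangle C A B"
    using assms by (simp_all add: minimally_inscribed_def triangle_def insert_commute)
  \<comment> \<open>Relabelling the vertices cyclically only permutes the three conclusions, so the
    completely inscribed angle may be taken at the last vertex.\<close>
  show ?thesis
    using assms taxi_excircles_of_completely_inscribed[of A B C]
      taxi_excircles_of_completely_inscribed[of B C A]
      taxi_excircles_of_completely_inscribed[of C A B] tri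
    unfolding minimally_inscribed_def by blast
qed

end
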